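(* Fix an integer $n\geq 2$ and real numbers $n_0<\cdots<n_{n-1}<M$ all belonging to the set $\mathcal{A}_n:=\mathbb{N}_0\cup[n-2,\infty)$. Suppose that $0<\rho\leq\infty$ and $c_{n_0},\ldots,c_{n_{n-1}}>0$, and, for $c'\in\mathbb{R}$, define $f_{c'}(x):=\sum_{j=0}^{n-1}c_{n_j}x^{n_j}+c'x^M$ for $x\in(0,\rho)$. Then, for every finite collection $A_1,\ldots,A_L\in\mathbb{P}_n((0,\rho))$, there exists $c'\in\mathbb{R}$ such that $$f_{c'}[A_\ell]\succeq 0,\qquad 1\leq\ell\leq L,$$ but $f_{c'}[-]$ does not preserve positivity on $\mathbb{P}_n((0,\rho))$, i.e. there exists $A\in\mathbb{P}_n((0,\rho))$ such that $f_{c'}[A]$ is not positive semidefinite.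
   Context: $\mathbb{N}_0=\{0,1,2,\ldots\}$. $\mathbb{P}_n(I)$ denotes the set of real symmetric positive semidefinite $n\times n$ matrices all of whose entries lie in $I$; $f[A]:=[f(a_{ij})]$ is the entrywise application of $f$; $\succeq 0$ means positive semidefinite. *)

theory Defs
  imports Complex_Main "HOL-Library.Extended_Real" "Jordan_Normal_Form.Matrix"
begin

definition pos_semidef :: "nat \<Rightarrow> real mat \<Rightarrow> bool" where
  "pos_semidef n A \<longleftrightarrow> A \<in> carrier_mat n n \<and> A\<^sup>T = A \<and>
     (\<forall>v \<in> carrier_vec n. 0 \<le> v \<bullet> (A *\<^sub>v v))"

definition psd_mats :: "nat \<Rightarrow> real set \<Rightarrow> real mat set" where
  "psd_mats n I = {A. pos_semidef n A \<and> elements_mat A \<subseteq> I}"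

text \<open>The real interval from 0 (excluded) to \<open>\<rho>\<close> (excluded); \<open>\<rho> = \<infinity>\<close> is allowed.\<close>

definition open_interval0 :: "ereal \<Rightarrow> real set" where
  "open_interval0 \<rho> = {x. 0 < x \<and> ereal x < \<rho>}"

text \<open>The lower bound is the real number \<open>n - 2\<close>, not a truncated difference.\<close>

definition exponents :: "nat \<Rightarrow> real set" where
  "exponents n = \<nat> \<union> {real n - 2 ..}"

text \<open>
  The coefficient \<open>c j\<close> belongs to the exponent \<open>e j\<close>. The function is of interest only for
  \<open>x > 0\<close>, where \<open>powr\<close> is the usual real power, with \<open>x powr 0 = 1\<close>.
\<close>

definition power_sum ::
  "nat \<Rightarrow> (nat \<Rightarrow> real) \<Rightarrow> (nat \<Rightarrow> real) \<Rightarrow> real \<Rightarrow> real \<Rightarrow> real \<Rightarrow> real" where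
  "power_sum n c e M c' x = (\<Sum>j<n. c j * x powr e j) + c' * x powr M"

end

theory Submission
  imports Defs
begin

text \<open>
  Real powers with exponents in \<open>exponents n\<close> preserve positivity on positive matrices
  (FitzGerald and Horn). The set of all \<open>c'\<close> for which positivity is preserved is closed and
  bounded below; let \<open>C\<close> be its minimum. If \<open>v\<close> is a null vector of \<open>f\<^sub>C[A]\<close>, then positivity at
  \<open>t A\<close> for some \<open>t > 1\<close> gives \<open>\<Sum> c\<^sub>j (t powr (e\<^sub>j - M) - 1) (v \<bullet> A powr e\<^sub>j v) \<ge> 0\<close>, in which all
  terms are nonpositive, so \<open>v\<close> is a null vector of every power \<open>A powr e\<^sub>j\<close>; as generalized
  Vandermonde matrices are nonsingular, also of \<open>A powr M\<close>. Hence the kernel of \<open>f\<^sub>C[A]\<close> is contained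
  in that of \<open>A powr M\<close>, and a small multiple of the latter matrix can be subtracted from the former.
\<close>

section \<open>Quadratic forms on a finite index set\<close>

text \<open>Forms live on an arbitrary index set and take functions as arguments, not vectors of a
  fixed dimension, so that proofs can go by induction on \<open>insert i S\<close>.\<close>

definition qform :: "'a set \<Rightarrow> ('a \<Rightarrow> 'a \<Rightarrow> real) \<Rightarrow> ('a \<Rightarrow> real) \<Rightarrow> real" where
  "qform S a v = (\<Sum>i\<in>S. \<Sum>j\<in>S. v i * v j * a i j)"

definition psd_on :: "'a set \<Rightarrow> ('a \<Rightarrow> 'a \<Rightarrow> real) \<Rightarrow> bool" where
  "psd_on S a \<longleftrightarrow> (\<forall>i\<in>S. \<forall>j\<in>S. a i j = a j i) \<and> (\<forall>v. 0 \<le> qform S a v)"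

lemma psd_on_sym: "psd_on S a \<Longrightarrow> i \<in> S \<Longrightarrow> j \<in> S \<Longrightarrow> a i j = a j i"
  by (auto simp: psd_on_def)

lemma psd_on_qform: "psd_on S a \<Longrightarrow> 0 \<le> qform S a v"
  by (auto simp: psd_on_def)

lemma qform_cong:
  assumes "\<And>i j. i \<in> S \<Longrightarrow> j \<in> S \<Longrightarrow> a i j = b i j" "\<And>i. i \<in> S \<Longrightarrow> v i = w i"
  shows "qform S a v = qform S b w"
  unfolding qform_def by (intro sum.cong refl) (simp add: assms)

lemma psd_on_cong:
  assumes "\<And>i j. i \<in> S \<Longrightarrow> j \<in> S \<Longrightarrow> a i j = b i j"
  shows "psd_on S a \<longleftrightarrow> psd_on S b"
proof -
  have "qform S a v = qform S b v" for v using assms by (intro qform_cong) auto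
  with assms show ?thesis by (auto simp: psd_on_def)
qed

lemma qform_add: "qform S (\<lambda>i j. a i j + b i j) v = qform S a v + qform S b v"
  by (simp add: qform_def sum.distrib distrib_left)

lemma qform_scale: "qform S (\<lambda>i j. k * a i j) v = k * qform S a v"
  by (simp add: qform_def sum_distrib_left mult_ac)

lemma qform_sum: "qform S (\<lambda>i j. \<Sum>k\<in>K. a k i j) v = (\<Sum>k\<in>K. qform S (a k) v)"
  unfolding qform_def sum_distrib_left
  by (subst sum.swap) (simp add: sum.swap[of _ _ K])

lemma qform_dyad: "qform S (\<lambda>i j. u i * u j) v = (\<Sum>i\<in>S. v i * u i)\<^sup>2"
  by (simp add: qform_def power2_eq_square sum_product mult_ac)

lemma qform_dyad_hadamard:
  "qform S (\<lambda>i j. u i * u j * a i j) v = qform S a (\<lambda>i. v i * u i)"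
  by (simp add: qform_def mult_ac)

lemma qform_unit:
  assumes "finite S" "i \<in> S"
  shows "qform S a (\<lambda>j. if j = i then 1 else 0) = a i i"
proof -
  have "qform S a (\<lambda>j. if j = i then 1 else 0) =
      (\<Sum>j\<in>S. if j = i then \<Sum>k\<in>S. if k = i then a i i else 0 else 0)"
    unfolding qform_def by (intro sum.cong refl) (auto intro!: sum.cong)
  with assms show ?thesis by simp
qed

lemma qform_insert:
  assumes "finite S" "i \<notin> S" "\<And>j. j \<in> S \<Longrightarrow> a j i = a i j"
  shows "qform (insert i S) a v =
    (v i)\<^sup>2 * a i i + 2 * v i * (\<Sum>j\<in>S. a i j * v j) + qform S a v"
proof -
  have "qform (insert i S) a v =
      v i * v i * a i i + (\<Sum>j\<in>S. v i * v j * a i j) + (\<Sum>j\<in>S. v j * v i * a j i) + qform S a v"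
    using assms(1,2) by (simp add: qform_def sum.distrib)
  also have "(\<Sum>j\<in>S. v i * v j * a i j) = v i * (\<Sum>j\<in>S. a i j * v j)"
    by (simp add: sum_distrib_left mult_ac)
  also have "(\<Sum>j\<in>S. v j * v i * a j i) = v i * (\<Sum>j\<in>S. a i j * v j)"
    by (simp add: sum_distrib_left mult_ac assms(3))
  finally show ?thesis by (simp add: power2_eq_square)
qed

lemma qform_insert_zero:
  assumes "finite S" "i \<notin> S" "\<And>j. j \<in> insert i S \<Longrightarrow> a i j = 0" "\<And>j. j \<in> S \<Longrightarrow> a j i = 0"
  shows "qform (insert i S) a v = qform S a v"
  using assms by (subst qform_insert) auto

lemma psd_on_insert_zero:
  assumes "finite S" "i \<notin> S" "\<And>j. j \<in> insert i S \<Longrightarrow> a i j = 0" "\<And>j. j \<in> S \<Longrightarrow> a j i = 0"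
  shows "psd_on (insert i S) a \<longleftrightarrow> psd_on S a"
proof -
  have "qform (insert i S) a v = qform S a v" for v
    using assms by (intro qform_insert_zero) auto
  with assms show ?thesis by (auto simp: psd_on_def)
qed

text \<open>Moving one coordinate gives a quadratic polynomial in \<open>t\<close>. Its linear
  coefficient is twice row \<open>i\<close> applied to \<open>v\<close>; inspecting this polynomial
  drives the results on null vectors, Schur complements and domination.\<close>

lemma qform_shift:
  assumes "finite S" "i \<in> S" "\<And>j. j \<in> S \<Longrightarrow> a j i = a i j"
  shows "qform S a (v(i := v i + t)) = qform S a v + 2 * t * (\<Sum>j\<in>S. a i j * v j) + t\<^sup>2 * a i i"
proof -
  define T where "T = S - {i}"
  have S: "S = insert i T" "finite T" "i \<notin> T" using assms by (auto simp: T_def)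
  define b where "b = (\<Sum>j\<in>T. a i j * v j)"
  have sym: "a j i = a i j" if "j \<in> T" for j using that assms(3) S(1) by blast
  have "qform T a (v(i := v i + t)) = qform T a v"
    using S(3) by (intro qform_cong) auto
  moreover have "(\<Sum>j\<in>T. a i j * (v(i := v i + t)) j) = b"
    unfolding b_def using S(3) by (intro sum.cong) auto
  ultimately have "qform S a (v(i := v i + t)) = (v i + t)\<^sup>2 * a i i + 2 * (v i + t) * b + qform T a v"
    unfolding S(1) using S(2,3) sym by (subst qform_insert) auto
  moreover have "qform S a v = (v i)\<^sup>2 * a i i + 2 * v i * b + qform T a v"
    unfolding S(1) b_def using S(2,3) sym by (subst qform_insert) auto
  moreover have "(\<Sum>j\<in>S. a i j * v j) = a i i * v i + b"
    using S by (simp add: b_def)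
  ultimately show ?thesis by (simp add: power2_eq_square algebra_simps)
qed

lemma psd_on_subset:
  assumes "finite S" "psd_on S a" "T \<subseteq> S"
  shows "psd_on T a"
proof -
  have "qform T a v = qform S a (\<lambda>i. if i \<in> T then v i else 0)" for v
    unfolding qform_def using assms
    by (intro sum.mono_neutral_cong_left)
      (auto intro!: sum.mono_neutral_cong_left)
  then have "0 \<le> qform T a v" for v using assms(2) by (simp add: psd_on_qform)
  with assms show ?thesis unfolding psd_on_def by blast
qed

lemma psd_on_diag:
  assumes "finite S" "psd_on S a" "i \<in> S"
  shows "0 \<le> a i i"
  using psd_on_qform[OF assms(2), of "\<lambda>j. if j = i then 1 else 0"] assms
  by (simp add: qform_unit)

text \<open>A nonnegative form has a minimum at each of its zeros, so its derivative in every
  coordinate direction vanishes there.\<close>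

lemma psd_on_null_vector:
  assumes "finite S" "psd_on S a" "qform S a v = 0" "i \<in> S"
  shows "(\<Sum>j\<in>S. a i j * v j) = 0"
proof (rule ccontr)
  define b where "b = (\<Sum>j\<in>S. a i j * v j)"
  assume "\<not> ?thesis"
  then have b: "b\<^sup>2 > 0" by (simp add: b_def)
  have d: "0 \<le> a i i" by (rule psd_on_diag[OF assms(1,2,4)])
  have "0 \<le> 2 * t * b + t\<^sup>2 * a i i" for t
    using qform_shift[of S i a v t] psd_on_qform[OF assms(2), of "v(i := v i + t)"] assms
    by (auto simp: psd_on_sym b_def)
  \<comment> \<open>The summand 1 keeps the denominator positive when \<open>a i i = 0\<close>; the
    linear term still outweighs the quadratic one.\<close>
  from this[of "- b / (1 + a i i)"] have "0 \<le> - 2 * b\<^sup>2 / (1 + a i i) + b\<^sup>2 * a i i / (1 + a i i)\<^sup>2"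
    by (simp add: power2_eq_square)
  also have "\<dots> = - (b\<^sup>2 * (2 + a i i)) / (1 + a i i)\<^sup>2"
    using d by (simp add: divide_simps) (simp add: power2_eq_square algebra_simps)
  also have "\<dots> < 0" using b d by (intro divide_neg_pos) auto
  finally show False by simp
qed

lemma psd_on_zero_row:
  assumes "finite S" "psd_on S a" "i \<in> S" "a i i = 0" "j \<in> S"
  shows "a i j = 0" "a j i = 0"
proof -
  define v where "v = (\<lambda>k. if k = i then 1 else 0 :: real)"
  have v: "(\<Sum>k\<in>S. b k * v k) = b i" for b
    using assms by (simp add: v_def if_distrib[of "\<lambda>x. _ * x"] cong: if_cong)
  have "qform S a v = 0" using assms by (simp add: v_def qform_unit)
  from psd_on_null_vector[OF assms(1,2) this assms(5)] show "a j i = 0" by (simp add: v)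
  with assms psd_on_sym show "a i j = 0" by metis
qed

section \<open>Schur complements and Schur products\<close>

lemma psd_on_schur_complement:
  assumes "finite S" "psd_on S a" "i \<in> S" "0 < a i i"
  shows "psd_on S (\<lambda>j k. a j k - a i j * a i k / a i i)"
  unfolding psd_on_def
proof (intro conjI ballI allI)
  fix v
  define b where "b = (\<Sum>j\<in>S. a i j * v j)"
  have b: "(\<Sum>j\<in>S. v j * a i j) = b" by (simp add: b_def mult.commute)
  have "qform S (\<lambda>j k. a j k + (- 1 / a i i) * (a i j * a i k)) v = qform S a v - b\<^sup>2 / a i i"
    unfolding qform_add qform_scale qform_dyad by (simp add: b)
  \<comment> \<open>The shift \<open>- b / a i i\<close> minimizes \<open>qform S a\<close> along
    coordinate \<open>i\<close>, and the minimum is the form of the complement at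
    \<open>v\<close>.\<close>
  also have "\<dots> = qform S a (v(i := v i + (- b / a i i)))"
  proof -
    have "qform S a (v(i := v i + t)) = qform S a v + 2 * t * b + t\<^sup>2 * a i i" for t
      unfolding b_def
      by (rule qform_shift[of S i a v t, OF assms(1,3)]) (rule psd_on_sym[OF assms(2) _ assms(3)])
    from this[of "- b / a i i"] have "qform S a (v(i := v i + - b / a i i)) =
        qform S a v - b\<^sup>2 / a i i"
      using assms(4) by (simp add: power2_eq_square)
    then show ?thesis by simp
  qed
  finally show "0 \<le> qform S (\<lambda>j k. a j k - a i j * a i k / a i i) v"
    using psd_on_qform[OF assms(2)] by simp
qed (use assms psd_on_sym in \<open>auto simp: mult_ac\<close>)

text \<open>Subtracting a rank one matrix from \<open>a\<close> clears row \<open>i\<close>, so the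
  induction hypothesis covers the rest. The Schur product of the subtracted dyad with
  \<open>b\<close> is the form of \<open>b\<close> at a rescaled vector, hence nonnegative.\<close>

theorem schur_product:
  assumes "finite S" "psd_on S a" "psd_on S b"
  shows "psd_on S (\<lambda>i j. a i j * b i j)"
  using assms
proof (induction S arbitrary: a rule: finite_induct)
  case empty
  then show ?case by (simp add: psd_on_def qform_def)
next
  case (insert i S)
  have bS: "psd_on S b" using insert psd_on_subset[of "insert i S" b S] by auto
  have sym: "a j k = a k j" "b j k = b k j" if "j \<in> insert i S" "k \<in> insert i S" for j k
    using that insert psd_on_sym by metis+
  \<comment> \<open>If \<open>a i i = 0\<close>, row \<open>i\<close> of \<open>a\<close> is already
    zero and nothing has to be subtracted.\<close>
  define a' where "a' = (if a i i = 0 then a else (\<lambda>j k. a j k - a i j * a i k / a i i))"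
  have d: "0 \<le> a i i" using insert psd_on_diag[of "insert i S" a i] by auto
  have a': "psd_on (insert i S) a'"
    using insert d psd_on_schur_complement[of "insert i S" a i] by (auto simp: a'_def)
  have diag: "a' i i = 0" by (simp add: a'_def)
  have row: "a' i j = 0" "a' j i = 0" if "j \<in> insert i S" for j
    using psd_on_zero_row[OF _ a' _ diag that] insert by auto
  have "psd_on S a'" using a' insert psd_on_subset[of "insert i S" a' S] by auto
  then have "psd_on S (\<lambda>j k. a' j k * b j k)" using insert bS by auto
  then have *: "psd_on (insert i S) (\<lambda>j k. a' j k * b j k)"
    using insert row by (subst psd_on_insert_zero) auto
  show ?case
  proof (cases "a i i = 0")
    case True
    with * show ?thesis by (simp add: a'_def)
  next
    case False
    have "qform (insert i S) (\<lambda>j k. a j k * b j k) v =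
        qform (insert i S) (\<lambda>j k. a' j k * b j k + (1 / a i i) * (a i j * a i k * b j k)) v" for v
      using False by (intro qform_cong) (auto simp: a'_def algebra_simps)
    then have "0 \<le> qform (insert i S) (\<lambda>j k. a j k * b j k) v" for v
      unfolding qform_add qform_scale qform_dyad_hadamard
      using d psd_on_qform[OF *] psd_on_qform[OF \<open>psd_on (insert i S) b\<close>] by simp
    with sym show ?thesis unfolding psd_on_def by metis
  qed
qed

lemma psd_on_one: "psd_on S (\<lambda>i j. 1)"
  using qform_dyad[of S "\<lambda>_. 1"] by (simp add: psd_on_def)

lemma psd_on_power:
  assumes "finite S" "psd_on S a"
  shows "psd_on S (\<lambda>i j. a i j ^ k)"
  by (induction k) (simp_all add: psd_on_one schur_product[OF assms])

section \<open>Sums and congruences of forms, and domination of one form by another\<close>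

lemma psd_on_add: "psd_on S a \<Longrightarrow> psd_on S b \<Longrightarrow> psd_on S (\<lambda>i j. a i j + b i j)"
  by (auto simp: psd_on_def qform_add)

lemma psd_on_scale: "0 \<le> k \<Longrightarrow> psd_on S a \<Longrightarrow> psd_on S (\<lambda>i j. k * a i j)"
  by (auto simp: psd_on_def qform_scale)

lemma psd_on_dyad: "psd_on S (\<lambda>i j. u i * u j)"
  by (auto simp: psd_on_def qform_dyad)

text \<open>Subtracting multiples of row and column \<open>i\<close> from the others amounts to
  substituting a linear function of the remaining coordinates for coordinate
  \<open>i\<close>.\<close>

lemma qform_congruence:
  assumes "finite S" "i \<notin> S" "\<And>j. j \<in> S \<Longrightarrow> a j i = a i j"
  shows "qform S (\<lambda>j k. a j k - l j * a i k - l k * a i j + l j * l k * a i i) v =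
    qform (insert i S) a (v(i := - (\<Sum>j\<in>S. l j * v j)))"
proof -
  define s where "s = (\<Sum>j\<in>S. l j * v j)"
  define b where "b = (\<Sum>j\<in>S. a i j * v j)"
  have cross: "qform S (\<lambda>j k. l j * a i k) v = s * b" "qform S (\<lambda>j k. l k * a i j) v = s * b"
    unfolding qform_def s_def b_def sum_product
    by (simp add: mult_ac) (subst sum.swap, simp add: mult_ac)
  have "qform S (\<lambda>j k. a j k + (-1) * (l j * a i k) + (-1) * (l k * a i j) + a i i * (l j * l k)) v =
      qform S a v - 2 * s * b + a i i * s\<^sup>2"
    unfolding qform_add qform_scale qform_dyad cross by (simp add: s_def mult_ac)
  moreover have "qform S a (v(i := - s)) = qform S a v"
    using assms by (intro qform_cong) auto
  moreover have "(\<Sum>j\<in>S. a i j * (v(i := - s)) j) = b"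
    unfolding b_def using assms by (intro sum.cong) auto
  ultimately show ?thesis
    using assms by (simp add: qform_insert s_def[symmetric] algebra_simps)
qed

text \<open>One index is eliminated at a time, by the same substitution in both forms, so the
  inclusion of null vectors passes to the smaller pair \<open>p'\<close>, \<open>q'\<close>.\<close>

lemma psd_on_dominated:
  assumes "finite S" "psd_on S p" "psd_on S q" "\<And>v. qform S p v = 0 \<Longrightarrow> qform S q v = 0"
  shows "\<exists>D>0. \<forall>v. qform S q v \<le> D * qform S p v"
  using assms
proof (induction S arbitrary: p q rule: finite_induct)
  case empty
  then show ?case by (auto simp: qform_def intro: exI[of _ 1])
next
  case (insert i S)
  note pq = \<open>psd_on (insert i S) p\<close> \<open>psd_on (insert i S) q\<close>
  have fin: "finite (insert i S)" using insert by simp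
  have sub: "psd_on S p" "psd_on S q" using psd_on_subset[OF fin] pq by blast+
  have symp: "p j k = p k j" and symq: "q j k = q k j" if "j \<in> insert i S" "k \<in> insert i S" for j k
    using that pq psd_on_sym by metis+
  have d: "0 \<le> p i i" "0 \<le> q i i" using psd_on_diag[OF fin] pq by auto
  show ?case
  proof (cases "p i i = 0")
    case True
    have q: "q i i = 0" using insert.prems(3)[of "\<lambda>j. if j = i then 1 else 0"] True fin by (simp add: qform_unit)
    have "qform (insert i S) p v = qform S p v" "qform (insert i S) q v = qform S q v" for v
      using insert(1,2) psd_on_zero_row[OF fin pq(1) _ True] psd_on_zero_row[OF fin pq(2) _ q]
      by (auto intro!: qform_insert_zero)
    then show ?thesis using insert.IH[OF sub] insert.prems(3) by auto
  next
    case False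
    with d have pos: "0 < p i i" by simp
    \<comment> \<open>These multipliers make row \<open>i\<close> of \<open>p\<close> vanish on
      \<open>w v\<close>, so \<open>p'\<close> is the Schur complement of \<open>p\<close> and no
      mixed term remains in \<open>p\<close>. In \<open>q\<close> a mixed term may survive.\<close>
    define l where "l = (\<lambda>j. p i j / p i i)"
    define w where "w = (\<lambda>v. v(i := - (\<Sum>j\<in>S. l j * v j)))"
    define p' where "p' = (\<lambda>j k. p j k - l j * p i k - l k * p i j + l j * l k * p i i)"
    define q' where "q' = (\<lambda>j k. q j k - l j * q i k - l k * q i j + l j * l k * q i i)"
    have p': "qform S p' v = qform (insert i S) p (w v)"
      and q': "qform S q' v = qform (insert i S) q (w v)" for v
      unfolding p'_def q'_def w_def using insert(1,2) symp symq by (auto intro!: qform_congruence)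
    have "psd_on S p'" "psd_on S q'"
      using p' q' pq symp symq by (auto simp: psd_on_def p'_def q'_def mult_ac)
    then obtain D where D: "D > 0" "\<And>v. qform S q' v \<le> D * qform S p' v"
      using insert.IH[of p' q'] insert.prems(3) p' q' by metis
    define r where "r = q i i / p i i"
    have r: "0 \<le> r" "q i i = r * p i i" using d pos by (auto simp: r_def)
    define E where "E = 2 * D + 2 * r"
    have "qform (insert i S) q v \<le> E * qform (insert i S) p v" for v
    proof -
      define t where "t = v i - w v i"
      have v: "v = (w v)(i := w v i + t)" by (auto simp: t_def w_def)
      have "(\<Sum>j\<in>insert i S. p i j * w v j) = p i i * w v i + (\<Sum>j\<in>S. p i j * v j)"
        using insert(1,2) by (simp add: w_def) (intro sum.cong; auto)
      also have "\<dots> = 0" using pos by (simp add: w_def l_def sum_divide_distrib[symmetric])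
      finally have pv: "qform (insert i S) p v = qform S p' v + t\<^sup>2 * p i i"
        using v qform_shift[OF fin, of i p "w v" t] symp p' by auto
      define b where "b = (\<Sum>j\<in>insert i S. q i j * w v j)"
      have sh: "qform (insert i S) q ((w v)(i := w v i + s)) = qform S q' v + 2 * (s * b) + s\<^sup>2 * q i i" for s
        unfolding b_def q' mult.assoc[symmetric] 
        by (rule qform_shift[of "insert i S" i q "w v" s, OF fin]) (simp, rule symq, auto)
      \<comment> \<open>Nonnegativity at the reflected shift \<open>- t\<close> bounds the mixed
        term of \<open>q\<close> by its two square terms, which costs the factor 2 in
        \<open>E\<close>.\<close>
      have "0 \<le> qform (insert i S) q ((w v)(i := w v i + - t))" using pq psd_on_qform by blast
      then have "qform (insert i S) q v \<le> 2 * qform S q' v + 2 * (t\<^sup>2 * q i i)"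
        using sh[of t] unfolding sh v[symmetric]
        by (simp only: power2_minus mult_minus_left mult_minus_right)
      moreover have "qform S q' v \<le> D * qform S p' v" by (rule D(2))
      moreover have "0 \<le> D * (t\<^sup>2 * p i i)" "0 \<le> r * qform S p' v"
        using D(1) d r(1) psd_on_qform[OF \<open>psd_on S p'\<close>] by simp_all
      moreover have "E * qform (insert i S) p v = 2 * (D * qform S p' v) +
          2 * (D * (t\<^sup>2 * p i i)) + 2 * (r * qform S p' v) + 2 * (t\<^sup>2 * q i i)"
        unfolding pv E_def r(2) by (simp add: algebra_simps)
      ultimately show ?thesis by linarith
    qed
    moreover have "E > 0" using D(1) r(1) by (simp add: E_def)
    ultimately show ?thesis by blast
  qed
qed

section \<open>Powers of positive matrices\<close>

text \<open>
  Along the segment from the rank one matrix \<open>z\<close> built from row \<open>i\<close> of \<open>a\<close> to \<open>a\<close> itself, the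
  quadratic form of the \<open>\<alpha>\<close>-th power is nondecreasing: its derivative is \<open>\<alpha>\<close> times the form of the
  Schur product of \<open>a - z\<close>, whose row \<open>i\<close> vanishes, with an \<open>(\<alpha> - 1)\<close>-th power.
\<close>

theorem fitzgerald_horn:
  assumes "finite S" "psd_on S a" "\<And>i j. i \<in> S \<Longrightarrow> j \<in> S \<Longrightarrow> 0 < a i j"
    and "real (card S) - 2 \<le> \<alpha>"
  shows "psd_on S (\<lambda>i j. a i j powr \<alpha>)"
  using assms
proof (induction S arbitrary: a \<alpha> rule: finite_induct)
  case empty
  then show ?case by (simp add: psd_on_def qform_def)
next
  case (insert i S)
  show ?case
  \<comment> \<open>A single index allows negative \<open>\<alpha>\<close>; from two indices on
    \<open>\<alpha> \<ge> 0\<close>, the sign needed for the factor \<open>\<alpha>\<close> in the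
    derivative. Dropping \<open>i\<close> lowers the bound by one, which matches the exponent
    \<open>\<alpha> - 1\<close>.\<close>
  proof (cases "S = {}")
    case True
    then show ?thesis by (simp add: psd_on_def qform_def)
  next
    case False
    then have "card S \<ge> 1" using insert(1) by (simp add: Suc_leI card_gt_0_iff)
    with insert.prems(3) insert(1,2) have \<alpha>: "0 \<le> \<alpha>" "real (card S) - 2 \<le> \<alpha> - 1" by auto
    have fin: "finite (insert i S)" using insert by simp
    note a = \<open>psd_on (insert i S) a\<close>
    have sym: "a j k = a k j" if "j \<in> insert i S" "k \<in> insert i S" for j k
      using that a psd_on_sym by metis
    have pos: "0 < a j k" if "j \<in> insert i S" "k \<in> insert i S" for j k
      using that insert.prems by auto
    have d: "0 < a i i" using pos by simp
    define z where "z = (\<lambda>j k. a i j * a i k / a i i)"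
    define g where "g = (\<lambda>x j k. z j k + x * (a j k - z j k))"
    have zpos: "0 < z j k" if "j \<in> insert i S" "k \<in> insert i S" for j k
      using that pos by (auto simp: z_def)
    have comp: "psd_on (insert i S) (\<lambda>j k. a j k - z j k)"
      unfolding z_def using psd_on_schur_complement[OF fin a, of i] d by simp
    have z: "psd_on (insert i S) z"
      using psd_on_scale[of "1 / a i i", OF _ psd_on_dyad[of "insert i S" "a i"]] d
      by (simp add: z_def)
    have row: "a i j - z i j = 0" "a j i - z j i = 0" if "j \<in> insert i S" for j
      using that d sym[of j i] by (auto simp: z_def)
    have gpos: "0 < g x j k" if "0 \<le> x" "x \<le> 1" "j \<in> insert i S" "k \<in> insert i S" for x j k
    proof -
      have "g x j k = (1 - x) * z j k + x * a j k" by (simp add: g_def algebra_simps)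
      moreover have "0 < (1 - x) * z j k + x * a j k"
      proof (cases "x = 1")
        case False
        with that show ?thesis using zpos[of j k] pos[of j k]
          by (intro add_pos_nonneg mult_pos_pos mult_nonneg_nonneg) auto
      qed (use pos that in simp)
      ultimately show ?thesis by simp
    qed
    have g: "psd_on (insert i S) (g x)" if "0 \<le> x" for x
      unfolding g_def using that by (intro psd_on_add psd_on_scale z comp)
    define g' where "g' = (\<lambda>x j k. \<alpha> * ((a j k - z j k) * g x j k powr (\<alpha> - 1)))"
    have g': "psd_on (insert i S) (g' x)" if "0 \<le> x" "x \<le> 1" for x
    proof -
      have "psd_on S (g x)" "psd_on S (\<lambda>j k. a j k - z j k)"
        using g[OF that(1)] comp psd_on_subset[OF fin] by blast+
      then have "psd_on S (\<lambda>j k. (a j k - z j k) * g x j k powr (\<alpha> - 1))"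
        using insert(1) gpos[OF that] \<alpha> by (intro schur_product insert.IH) auto
      then have "psd_on (insert i S) (\<lambda>j k. (a j k - z j k) * g x j k powr (\<alpha> - 1))"
        using insert(1,2) row by (subst psd_on_insert_zero) auto
      then show ?thesis unfolding g'_def by (rule psd_on_scale[OF \<alpha>(1)])
    qed
    have "0 \<le> qform (insert i S) (\<lambda>j k. a j k powr \<alpha>) v" for v
    proof -
      define \<phi> where "\<phi> = (\<lambda>x. qform (insert i S) (\<lambda>j k. g x j k powr \<alpha>) v)"
      have "(\<phi> has_real_derivative qform (insert i S) (g' x) v) (at x)" if "0 \<le> x" "x \<le> 1" for x
      proof -
        have "((\<lambda>x. g x j k powr \<alpha>) has_real_derivative g' x j k) (at x)"
          if "j \<in> insert i S" "k \<in> insert i S" for j k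
        proof -
          have "((\<lambda>x. g x j k) has_real_derivative (a j k - z j k)) (at x)"
            unfolding g_def by (auto intro!: derivative_eq_intros)
          from DERIV_fun_powr[OF this gpos] that \<open>0 \<le> x\<close> \<open>x \<le> 1\<close>
          show ?thesis by (simp add: g'_def mult_ac)
        qed
        then show ?thesis unfolding \<phi>_def qform_def
          by (intro DERIV_sum DERIV_cmult) auto
      qed
      then have "\<phi> 0 \<le> \<phi> 1"
        using g' psd_on_qform by (intro DERIV_nonneg_imp_nondecreasing[of 0 1 \<phi>]) force+
      moreover have "\<phi> 1 = qform (insert i S) (\<lambda>j k. a j k powr \<alpha>) v"
        by (simp add: \<phi>_def g_def)
      \<comment> \<open>The power of a rank one positive matrix has rank one again, so the form is
        nonnegative at the start of the segment.\<close>
      moreover have "\<phi> 0 = qform (insert i S)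
          (\<lambda>j k. (1 / a i i powr \<alpha>) * (a i j powr \<alpha> * a i k powr \<alpha>)) v"
        unfolding \<phi>_def g_def z_def using pos
        by (intro qform_cong) (auto simp: powr_mult powr_divide less_imp_le)
      moreover have "0 \<le> qform (insert i S)
          (\<lambda>j k. (1 / a i i powr \<alpha>) * (a i j powr \<alpha> * a i k powr \<alpha>)) v"
        unfolding qform_scale qform_dyad by simp
      ultimately show ?thesis by linarith
    qed
    then show ?thesis using sym unfolding psd_on_def by metis
  qed
qed

text \<open>Natural exponents come from repeated Schur products, the remaining ones from
  \<open>fitzgerald_horn\<close>.\<close>

lemma psd_on_powr:
  assumes "finite S" "psd_on S a" "\<And>i j. i \<in> S \<Longrightarrow> j \<in> S \<Longrightarrow> 0 < a i j"
    and "\<alpha> \<in> exponents (card S)"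
  shows "psd_on S (\<lambda>i j. a i j powr \<alpha>)"
proof (cases "\<alpha> \<in> \<nat>")
  case True
  then obtain k where k: "\<alpha> = real k" by (auto elim: Nats_cases)
  have "psd_on S (\<lambda>i j. a i j ^ k)" using assms psd_on_power by blast
  then show ?thesis using assms(3)
    by (subst psd_on_cong[where b = "\<lambda>i j. a i j ^ k"]) (auto simp: k powr_realpow)
qed (use assms in \<open>auto simp: exponents_def intro!: fitzgerald_horn\<close>)

section \<open>Zeros of exponential sums\<close>

text \<open>By Rolle's theorem, after multiplication by \<open>exp (- x t)\<close> to make the term of \<open>x\<close> constant.\<close>

lemma exp_sum_zeros:
  fixes e :: "nat \<Rightarrow> real"
  assumes "finite Y" "card Y \<le> n" "\<And>i j. i < j \<Longrightarrow> j < n \<Longrightarrow> e i < e j"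
    and "\<And>j. j < n \<Longrightarrow> (\<Sum>y\<in>Y. w y * exp (y * e j)) = 0" "y \<in> Y"
  shows "w y = 0"
  using assms
proof (induction Y arbitrary: n e w y rule: finite_induct)
  case empty
  then show ?case by simp
next
  case (insert x Y)
  then obtain m where n: "n = Suc m" "card Y \<le> m" by (cases n) auto
  define h where "h = (\<lambda>t. w x + (\<Sum>y\<in>Y. w y * exp ((y - x) * t)))"
  define h' where "h' = (\<lambda>t. \<Sum>y\<in>Y. w y * (y - x) * exp ((y - x) * t))"
  have h': "(h has_real_derivative h' t) (at t)" for t
    unfolding h_def h'_def by (auto intro!: derivative_eq_intros sum.cong)
  have h0: "h (e j) = 0" if "j < n" for j
  proof -
    have "h (e j) = exp (- x * e j) * (\<Sum>y\<in>insert x Y. w y * exp (y * e j))"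
      using insert(1,2) by (simp add: h_def sum_distrib_left distrib_left algebra_simps flip: exp_add)
    with insert.prems(3) that show ?thesis by simp
  qed
  \<comment> \<open>Each gap between consecutive zeros of \<open>h\<close> contains a zero of
    \<open>h'\<close>; as the gaps are disjoint, these \<open>m\<close> zeros are again
    increasing.\<close>
  have "\<exists>t. e j < t \<and> t < e (Suc j) \<and> h' t = 0" if "j < m" for j
  proof -
    have "e j < e (Suc j)" using insert.prems(2) n that by simp
    moreover have "continuous_on {e j..e (Suc j)} h"
      using h' by (meson DERIV_isCont continuous_at_imp_continuous_on)
    moreover have "h (e j) = h (e (Suc j))" using h0 n that by simp
    ultimately obtain t where "e j < t" "t < e (Suc j)" "(h has_real_derivative 0) (at t)"
      using Rolle[of "e j" "e (Suc j)" h] h' real_differentiable_def by blast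
    with h'[of t] show ?thesis using DERIV_unique by blast
  qed
  then obtain s where s: "\<And>j. j < m \<Longrightarrow> e j < s j \<and> s j < e (Suc j) \<and> h' (s j) = 0" by metis
  have smono: "s i < s j" if "i < j" "j < m" for i j
  proof -
    have "e (Suc i) \<le> e j"
      using insert.prems(2)[of "Suc i" j] that n by (cases "Suc i = j") auto
    with s[of i] s[of j] that show ?thesis by simp
  qed
  \<comment> \<open>Differentiation has removed the term of \<open>x\<close> and multiplied the
    others by \<open>y - x\<close>, which is nonzero because \<open>x\<close> is not in
    \<open>Y\<close>.\<close>
  have zero: "w y = 0" if "y \<in> Y" for y
  proof -
    have "(\<Sum>y\<in>Y. (w y * (y - x)) * exp (y * s j)) = 0" if "j < m" for j
    proof -
      have "(\<Sum>y\<in>Y. (w y * (y - x)) * exp (y * s j)) = exp (x * s j) * h' (s j)"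
        by (simp add: h'_def sum_distrib_left algebra_simps flip: exp_add)
      with s[OF that] show ?thesis by simp
    qed
    then have "w y * (y - x) = 0"
      using insert.IH[of m s "\<lambda>y. w y * (y - x)" y] n(2) smono that by blast
    with that insert(2) show ?thesis by auto
  qed
  \<comment> \<open>Now \<open>h\<close> is the constant \<open>w x\<close>, and it vanishes at
    \<open>e 0\<close>.\<close>
  with h0[of 0] n have "w x = 0" by (simp add: h_def)
  with zero insert.prems show ?case by auto
qed

text \<open>Some \<open>x k\<close> may coincide. Collecting the coefficients of equal logarithms in
  \<open>w\<close> leaves a sum of distinct exponentials with at least as many zeros as terms, so
  all collected weights vanish and the sum is zero for every exponent.\<close>

lemma powr_sum_zero:
  fixes e :: "nat \<Rightarrow> real"
  assumes "finite S" "card S \<le> n" "\<And>i j. i < j \<Longrightarrow> j < n \<Longrightarrow> e i < e j"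
    and "\<And>k. k \<in> S \<Longrightarrow> 0 < x k" "\<And>j. j < n \<Longrightarrow> (\<Sum>k\<in>S. x k powr e j * v k) = 0"
  shows "(\<Sum>k\<in>S. x k powr M * v k) = 0"
proof -
  define Y where "Y = (\<lambda>k. ln (x k)) ` S"
  define w where "w = (\<lambda>y. \<Sum>k\<in>{k \<in> S. ln (x k) = y}. v k)"
  have group: "(\<Sum>k\<in>S. x k powr \<alpha> * v k) = (\<Sum>y\<in>Y. w y * exp (y * \<alpha>))" for \<alpha>
  proof -
    have "(\<Sum>k\<in>S. x k powr \<alpha> * v k) = (\<Sum>k\<in>S. v k * exp (ln (x k) * \<alpha>))"
      by (intro sum.cong refl) (use assms(4) in \<open>force simp: powr_def mult_ac\<close>)
    also have "\<dots> = (\<Sum>y\<in>Y. \<Sum>k\<in>{k \<in> S. ln (x k) = y}. v k * exp (ln (x k) * \<alpha>))"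
      unfolding Y_def by (rule sum.image_gen[OF assms(1)])
    finally show ?thesis by (simp add: w_def sum_distrib_right)
  qed
  have "finite Y" "card Y \<le> n"
    using assms(1,2) card_image_le[OF assms(1), of "\<lambda>k. ln (x k)"] by (auto simp: Y_def)
  then have "w y = 0" if "y \<in> Y" for y
    using exp_sum_zeros[of Y n e w y] assms(3,5) that group by metis
  then show ?thesis by (simp add: group)
qed

section \<open>Entrywise power sums\<close>

lemma pos_semidef_iff:
  "pos_semidef n A \<longleftrightarrow> A \<in> carrier_mat n n \<and> psd_on {..<n} (\<lambda>i j. A $$ (i, j))"
proof (cases "A \<in> carrier_mat n n")
  case True
  have q: "v \<bullet> (A *\<^sub>v v) = qform {..<n} (\<lambda>i j. A $$ (i, j)) (\<lambda>i. v $ i)" if "v \<in> carrier_vec n" for v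
    using True that
    by (auto simp: scalar_prod_def qform_def sum_distrib_left mult_ac atLeast0LessThan intro!: sum.cong)
  have "(\<forall>v\<in>carrier_vec n. 0 \<le> v \<bullet> (A *\<^sub>v v)) \<longleftrightarrow> (\<forall>v. 0 \<le> qform {..<n} (\<lambda>i j. A $$ (i, j)) v)"
  proof (intro iffI allI ballI)
    fix v assume "\<forall>v\<in>carrier_vec n. 0 \<le> v \<bullet> (A *\<^sub>v v)"
    then have "0 \<le> qform {..<n} (\<lambda>i j. A $$ (i, j)) (\<lambda>i. vec n v $ i)" using q by auto
    also have "\<dots> = qform {..<n} (\<lambda>i j. A $$ (i, j)) v" by (intro qform_cong) auto
    finally show "0 \<le> qform {..<n} (\<lambda>i j. A $$ (i, j)) v" .
  qed (simp add: q)
  moreover have "A\<^sup>T = A \<longleftrightarrow> (\<forall>i\<in>{..<n}. \<forall>j\<in>{..<n}. A $$ (i, j) = A $$ (j, i))"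
    using True by (auto simp: mat_eq_iff)
  ultimately show ?thesis using True by (simp add: pos_semidef_def psd_on_def)
qed (simp add: pos_semidef_def)

lemma psd_mats_iff:
  "A \<in> psd_mats n I \<longleftrightarrow> A \<in> carrier_mat n n \<and> psd_on {..<n} (\<lambda>i j. A $$ (i, j)) \<and>
    (\<forall>i<n. \<forall>j<n. A $$ (i, j) \<in> I)"
  unfolding psd_mats_def pos_semidef_iff
  by auto

lemma pos_semidef_map_mat:
  assumes "A \<in> carrier_mat n n"
  shows "pos_semidef n (map_mat f A) \<longleftrightarrow> psd_on {..<n} (\<lambda>i j. f (A $$ (i, j)))"
proof -
  have "psd_on {..<n} (\<lambda>i j. map_mat f A $$ (i, j)) \<longleftrightarrow> psd_on {..<n} (\<lambda>i j. f (A $$ (i, j)))"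
    using assms by (intro psd_on_cong) auto
  with assms show ?thesis by (simp add: pos_semidef_iff)
qed

lemma mat_in_psd_mats_iff:
  "mat n n (\<lambda>(i, j). g i j) \<in> psd_mats n I \<longleftrightarrow> psd_on {..<n} g \<and> (\<forall>i<n. \<forall>j<n. g i j \<in> I)"
proof -
  have "psd_on {..<n} (\<lambda>i j. mat n n (\<lambda>(i, j). g i j) $$ (i, j)) \<longleftrightarrow> psd_on {..<n} g"
    by (intro psd_on_cong) auto
  then show ?thesis by (simp add: psd_mats_iff)
qed

section \<open>Forms of power sums and their null vectors\<close>

lemma qform_power_sum:
  "qform S (\<lambda>i j. power_sum n c e M c' (a i j)) v =
    (\<Sum>k<n. c k * qform S (\<lambda>i j. a i j powr e k) v) + c' * qform S (\<lambda>i j. a i j powr M) v"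
  unfolding power_sum_def qform_add qform_sum qform_scale ..

lemma psd_on_power_sum:
  assumes "finite S" "psd_on S a" "\<And>i j. i \<in> S \<Longrightarrow> j \<in> S \<Longrightarrow> 0 < a i j"
    and "\<And>k. k < n \<Longrightarrow> e k \<in> exponents (card S)" "\<And>k. k < n \<Longrightarrow> 0 \<le> c k"
  shows "psd_on S (\<lambda>i j. power_sum n c e M 0 (a i j))"
proof -
  have "0 \<le> qform S (\<lambda>i j. power_sum n c e M 0 (a i j)) v" for v
  proof -
    have "0 \<le> c k * qform S (\<lambda>i j. a i j powr e k) v" if "k < n" for k
      using assms(5)[OF that] psd_on_qform[OF psd_on_powr[OF assms(1-3) assms(4)[OF that]]]
      by simp
    then show ?thesis unfolding qform_power_sum by (auto intro: sum_nonneg)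
  qed
  then show ?thesis using psd_on_sym[OF assms(2)] by (simp add: psd_on_def)
qed

text \<open>A null vector is annihilated by each row of each power, so every row of \<open>a\<close>
  satisfies the hypotheses of \<open>powr_sum_zero\<close>, with as many exponents as
  indices.\<close>

lemma common_null_vector:
  fixes e :: "nat \<Rightarrow> real"
  assumes "finite S" "\<And>i j. i \<in> S \<Longrightarrow> j \<in> S \<Longrightarrow> 0 < a i j"
    and "\<And>i j. i < j \<Longrightarrow> j < card S \<Longrightarrow> e i < e j"
    and "\<And>k. k < card S \<Longrightarrow> psd_on S (\<lambda>i j. a i j powr e k)"
    and "\<And>k. k < card S \<Longrightarrow> qform S (\<lambda>i j. a i j powr e k) v = 0"
  shows "qform S (\<lambda>i j. a i j powr M) v = 0"
proof -
  have "(\<Sum>j\<in>S. a i j powr M * v j) = 0" if "i \<in> S" for i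
    by (rule powr_sum_zero[OF assms(1) order_refl assms(3)])
      (use assms(2) that psd_on_null_vector[OF assms(1,4,5)] in auto)
  moreover have "qform S b v = (\<Sum>i\<in>S. v i * (\<Sum>j\<in>S. b i j * v j))" for b
    by (simp add: qform_def sum_distrib_left mult_ac)
  ultimately show ?thesis by simp
qed

text \<open>The finitely many entries have a bound \<open>m\<close> below \<open>\<rho>\<close>,
  which leaves room for some \<open>r\<close> with \<open>m < r < \<rho>\<close>; the factor is
  \<open>r / m\<close>.\<close>

lemma psd_mats_scale_up:
  assumes "A \<in> psd_mats n (open_interval0 \<rho>)" "0 < \<rho>"
  obtains t where "t > 1" "mat n n (\<lambda>(i, j). t * A $$ (i, j)) \<in> psd_mats n (open_interval0 \<rho>)"
proof -
  define X where "X = (\<lambda>(i, j). A $$ (i, j)) ` ({..<n} \<times> {..<n})"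
  have A: "psd_on {..<n} (\<lambda>i j. A $$ (i, j))" "\<And>x. x \<in> X \<Longrightarrow> 0 < x \<and> ereal x < \<rho>"
    using assms by (auto simp: psd_mats_iff open_interval0_def X_def)
  have "\<exists>m>0. ereal m < \<rho> \<and> (\<forall>x\<in>X. x \<le> m)"
  proof (cases "X = {}")
    case True
    obtain m where "0 < ereal m" "ereal m < \<rho>" using ereal_dense2[OF assms(2)] by blast
    with True show ?thesis by auto
  next
    case False
    moreover have "finite X" by (simp add: X_def)
    ultimately show ?thesis using A(2) Max_in[of X] Max_ge[of X] by blast
  qed
  then obtain m where m: "m > 0" "ereal m < \<rho>" "\<And>x. x \<in> X \<Longrightarrow> x \<le> m" by blast
  obtain r where r: "ereal m < ereal r" "ereal r < \<rho>" using ereal_dense2[OF m(2)] by blast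
  show ?thesis
  proof (rule that[of "r / m"])
    have rm: "m < r" using r(1) by simp
    with m show "r / m > 1" by simp
    have "0 < r / m * x \<and> ereal (r / m * x) < \<rho>" if "x \<in> X" for x
    proof -
      have "r / m * x \<le> r / m * m" using m rm that by (intro mult_left_mono) auto
      with m(1) have "ereal (r / m * x) \<le> ereal r" by simp
      with r(2) have "ereal (r / m * x) < \<rho>" by (rule order.strict_trans1[rotated])
      with m(1) rm A(2)[OF that] show ?thesis by simp
    qed
    moreover have "psd_on {..<n} (\<lambda>i j. r / m * A $$ (i, j))"
      by (rule psd_on_scale[OF _ A(1)]) (use m rm in simp)
    ultimately show "mat n n (\<lambda>(i, j). r / m * A $$ (i, j)) \<in> psd_mats n (open_interval0 \<rho>)"
      unfolding mat_in_psd_mats_iff by (auto simp: open_interval0_def X_def)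
  qed
qed

lemma power_sum_null_vector:
  fixes e c :: "nat \<Rightarrow> real"
  assumes "finite S" "psd_on S a" "\<And>i j. i \<in> S \<Longrightarrow> j \<in> S \<Longrightarrow> 0 < a i j"
    and "\<And>k. k < card S \<Longrightarrow> e k \<in> exponents (card S)" "\<And>k. k < card S \<Longrightarrow> 0 < c k"
    and "\<And>i j. i < j \<Longrightarrow> j < card S \<Longrightarrow> e i < e j" "\<And>k. k < card S \<Longrightarrow> e k < M"
    and "t > 1" "psd_on S (\<lambda>i j. power_sum (card S) c e M C (t * a i j))"
    and "qform S (\<lambda>i j. power_sum (card S) c e M C (a i j)) v = 0"
  shows "qform S (\<lambda>i j. a i j powr M) v = 0"
proof (rule common_null_vector[where e = e])
  define q where "q = (\<lambda>\<alpha>. qform S (\<lambda>i j. a i j powr \<alpha>) v)"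
  define N where "N = card S"
  have psd: "psd_on S (\<lambda>i j. a i j powr e k)" if "k < N" for k
    by (rule psd_on_powr[OF assms(1-3) assms(4)]) (use that in \<open>simp_all add: N_def\<close>)
  have pos: "0 \<le> q (e k)" if "k < N" for k
    using psd[OF that] by (auto simp: q_def psd_on_qform)
  have scale: "qform S (\<lambda>i j. (t * a i j) powr \<alpha>) v = t powr \<alpha> * q \<alpha>" for \<alpha>
    unfolding q_def qform_scale[symmetric] using assms(3,8)
    by (intro qform_cong) (auto simp: powr_mult less_imp_le)
  \<comment> \<open>The null equation at \<open>a\<close> expresses \<open>C * q M\<close> by the
    other terms; inserting this at \<open>t * a\<close> eliminates \<open>C\<close>, whatever its
    sign.\<close>
  have eq: "C * q M = - (\<Sum>k<N. c k * q (e k))"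
    using assms(10) by (simp add: qform_power_sum q_def N_def)
  have "0 \<le> (\<Sum>k<N. c k * (t powr e k * q (e k))) + C * (t powr M * q M)"
    using psd_on_qform[OF assms(9), of v] by (simp add: qform_power_sum scale N_def)
  also have "C * (t powr M * q M) = - (\<Sum>k<N. c k * (t powr M * q (e k)))"
    using arg_cong[OF eq, of "\<lambda>x. t powr M * x"] by (simp add: sum_distrib_left mult_ac)
  finally have "0 \<le> - (\<Sum>k<N. c k * ((t powr M - t powr e k) * q (e k)))"
    by (simp add: algebra_simps sum_subtractf)
  moreover have less: "t powr e k < t powr M" if "k < N" for k
    using assms(7,8) that by (simp add: N_def)
  then have nonneg: "0 \<le> c k * ((t powr M - t powr e k) * q (e k))" if "k < N" for k
    using pos assms(5) that less_imp_le N_def by (intro mult_nonneg_nonneg) force+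
  ultimately have "(\<Sum>k<N. c k * ((t powr M - t powr e k) * q (e k))) = 0"
    using sum_nonneg[of "{..<N}" "\<lambda>k. c k * ((t powr M - t powr e k) * q (e k))"] by force
  then have zero: "c k * ((t powr M - t powr e k) * q (e k)) = 0" if "k < N" for k
    using nonneg that by (subst (asm) sum_nonneg_eq_0_iff) auto
  show "qform S (\<lambda>i j. a i j powr e k) v = 0" if "k < card S" for k
    using zero[of k] less[of k] assms(5)[of k] that by (auto simp: N_def q_def)
  show "psd_on S (\<lambda>i j. a i j powr e k)" if "k < card S" for k
    using psd that by (simp add: N_def)
qed (use assms in auto)

section \<open>The smallest admissible coefficient and its perturbation\<close>

theorem proposition6p6:
  fixes n L :: nat and e c :: "nat \<Rightarrow> real" and M :: real and \<rho> :: ereal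
    and A :: "nat \<Rightarrow> real mat"
  assumes "n \<ge> 2"
    and "\<And>j. j < n \<Longrightarrow> e j \<in> exponents n"
    and "M \<in> exponents n"
    and "\<And>i j. i < j \<Longrightarrow> j < n \<Longrightarrow> e i < e j"
    and "e (n - 1) < M"
    and "0 < \<rho>"
    and "\<And>j. j < n \<Longrightarrow> 0 < c j"
    and "\<And>l. 1 \<le> l \<Longrightarrow> l \<le> L \<Longrightarrow> A l \<in> psd_mats n (open_interval0 \<rho>)"
  shows "\<exists>c' :: real.
    (\<forall>l. 1 \<le> l \<and> l \<le> L \<longrightarrow> pos_semidef n (map_mat (power_sum n c e M c') (A l))) \<and>
    (\<exists>B \<in> psd_mats n (open_interval0 \<rho>). \<not> pos_semidef n (map_mat (power_sum n c e M c') B))"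
proof -
  let ?P = "psd_mats n (open_interval0 \<rho>)"
  let ?q = "\<lambda>B \<alpha>. qform {..<n} (\<lambda>i j. B $$ (i, j) powr \<alpha>)"
  let ?f = "\<lambda>B d. qform {..<n} (\<lambda>i j. power_sum n c e M d (B $$ (i, j)))"
  have B: "B \<in> carrier_mat n n" "psd_on {..<n} (\<lambda>i j. B $$ (i, j))"
    "\<And>i j. i < n \<Longrightarrow> j < n \<Longrightarrow> 0 < B $$ (i, j)" if "B \<in> ?P" for B
    using that by (auto simp: psd_mats_iff open_interval0_def)
  have sym: "B $$ (i, j) = B $$ (j, i)" if "B \<in> ?P" "i < n" "j < n" for B i j
    using psd_on_sym[OF B(2)] that by simp
  have preserved_iff: "pos_semidef n (map_mat (power_sum n c e M d) B) \<longleftrightarrow> (\<forall>v. 0 \<le> ?f B d v)"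
    if "B \<in> ?P" for B d
    using B(1)[OF that] sym[OF that] by (auto simp: pos_semidef_map_mat psd_on_def)
  have shift: "?f B d v = ?f B 0 v + d * ?q B M v" for B d v
    by (simp add: qform_power_sum)
  have eM: "e k < M" if "k < n" for k
    using assms(4)[of k "n - 1"] assms(5) that by (cases "k = n - 1") fastforce+
  have qM: "psd_on {..<n} (\<lambda>i j. B $$ (i, j) powr M)" if "B \<in> ?P" for B
    using psd_on_powr[OF finite_lessThan B(2)[OF that], of M] B(3)[OF that] assms(3) by simp
  define K where "K = {d. \<forall>B\<in>?P. pos_semidef n (map_mat (power_sum n c e M d) B)}"
  have K_iff: "d \<in> K \<longleftrightarrow> (\<forall>B\<in>?P. \<forall>v. 0 \<le> ?f B d v)" for d
    by (auto simp: K_def preserved_iff)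
  have "psd_on {..<n} (\<lambda>i j. power_sum n c e M 0 (B $$ (i, j)))" if "B \<in> ?P" for B
    by (rule psd_on_power_sum[OF finite_lessThan B(2)[OF that]])
      (use B(3)[OF that] assms(2,7) in \<open>auto simp: less_imp_le\<close>)
  then have K0: "0 \<in> K" unfolding K_iff using psd_on_qform by blast
  \<comment> \<open>A constant matrix, tested on the first unit vector, forces the value of the
    function at \<open>x\<close> to be nonnegative; this bounds \<open>K\<close> below.\<close>
  obtain x where x: "0 < x" "ereal x < \<rho>" using ereal_dense2[OF assms(6)] by auto
  have xP: "mat n n (\<lambda>(i, j). x) \<in> ?P"
    using x psd_on_scale[OF less_imp_le[OF x(1)] psd_on_one[of "{..<n}"]]
    unfolding mat_in_psd_mats_iff by (simp add: open_interval0_def)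
  have "- (\<Sum>j<n. c j * x powr e j) / x powr M \<le> d" if "d \<in> K" for d
  proof -
    have "0 \<le> ?f (mat n n (\<lambda>(i, j). x)) d (\<lambda>j. if j = 0 then 1 else 0)" using that xP K_iff by blast
    then have "0 \<le> power_sum n c e M d x" using assms(1) by (simp add: qform_unit)
    with x(1) show ?thesis by (simp add: power_sum_def field_simps)
  qed
  then have bdd: "bdd_below K" by (auto simp: bdd_below_def)
  define C where "C = Inf K"
  \<comment> \<open>Each defining inequality of \<open>K\<close> is affine in \<open>d\<close> with
    slope \<open>?q B M v \<ge> 0\<close>, so it persists at the infimum.\<close>
  have "C \<in> K" unfolding K_iff
  proof (intro ballI allI)
    fix B v assume "B \<in> ?P"
    then have le: "0 \<le> ?f B 0 v + d * ?q B M v" if "d \<in> K" for d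
      using that K_iff shift by metis
    have qn: "0 \<le> ?q B M v" using qM[OF \<open>B \<in> ?P\<close>] psd_on_qform by blast
    show "0 \<le> ?f B C v"
    proof (cases "?q B M v = 0")
      case True
      then show ?thesis using le[OF K0] shift[of C B v] by simp
    next
      case False
      with qn have qp: "0 < ?q B M v" by simp
      have "- ?f B 0 v / ?q B M v \<le> d" if "d \<in> K" for d
        using le[OF that] unfolding pos_divide_le_eq[OF qp] by linarith
      then have "- ?f B 0 v / ?q B M v \<le> C" unfolding C_def using K0 by (intro cInf_greatest) auto
      then have "- ?f B 0 v \<le> C * ?q B M v" unfolding pos_divide_le_eq[OF qp] .
      then show ?thesis using shift[of C B v] by linarith
    qed
  qed
  have "\<exists>\<epsilon>>0. \<forall>d. 0 \<le> d \<and> d \<le> \<epsilon> \<longrightarrow> pos_semidef n (map_mat (power_sum n c e M (C - d)) B)"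
    if "B \<in> ?P" for B
  proof -
    obtain t where t: "t > 1" "mat n n (\<lambda>(i, j). t * B $$ (i, j)) \<in> ?P"
      using psd_mats_scale_up[OF \<open>B \<in> ?P\<close> assms(6)] .
    have fC: "psd_on {..<n} (\<lambda>i j. power_sum n c e M C (B $$ (i, j)))" if "B \<in> ?P" for B
      using \<open>C \<in> K\<close> that pos_semidef_map_mat[OF B(1)[OF that]] unfolding K_def by blast
    have "psd_on {..<n} (\<lambda>i j. power_sum n c e M C (mat n n (\<lambda>(i, j). t * B $$ (i, j)) $$ (i, j))) \<longleftrightarrow>
        psd_on {..<n} (\<lambda>i j. power_sum n c e M C (t * B $$ (i, j)))"
      by (intro psd_on_cong) auto
    with fC[OF t(2)] have tB: "psd_on {..<n} (\<lambda>i j. power_sum n c e M C (t * B $$ (i, j)))" by blast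
    have "?q B M v = 0" if "?f B C v = 0" for v
      using power_sum_null_vector[where S = "{..<n}" and a = "\<lambda>i j. B $$ (i, j)" and e = e
          and c = c and M = M and t = t and C = C and v = v]
        B(2,3)[OF \<open>B \<in> ?P\<close>] assms(2,4,7) eM t(1) tB that by simp
    then obtain D where D: "D > 0" "\<And>v. ?q B M v \<le> D * ?f B C v"
      using psd_on_dominated[OF finite_lessThan fC[OF \<open>B \<in> ?P\<close>] qM[OF \<open>B \<in> ?P\<close>]] by blast
    show ?thesis
    \<comment> \<open>Since \<open>?q B M v \<le> D * ?f B C v\<close>, up to \<open>1 / D\<close>
      times the \<open>M\<close>-th power can be subtracted.\<close>
    proof (intro exI[of _ "1 / D"] conjI allI impI)
      fix d assume d: "0 \<le> d \<and> d \<le> 1 / D"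
      show "pos_semidef n (map_mat (power_sum n c e M (C - d)) B)"
        unfolding preserved_iff[OF that]
      proof
        fix v
        have "d * ?q B M v \<le> 1 / D * ?q B M v"
          using d qM[OF that] psd_on_qform by (intro mult_right_mono) auto
        also have "\<dots> \<le> ?f B C v" using D(1) D(2)[of v] by (simp add: divide_le_eq mult.commute)
        finally have "d * ?q B M v \<le> ?f B 0 v + C * ?q B M v" using shift by metis
        then show "0 \<le> ?f B (C - d) v" unfolding shift[of "C - d" B v] by (simp add: algebra_simps)
      qed
    qed (use D in simp)
  qed
  then obtain \<epsilon> where \<epsilon>: "\<And>B. B \<in> ?P \<Longrightarrow> \<epsilon> B > 0"
    "\<And>B d. B \<in> ?P \<Longrightarrow> 0 \<le> d \<Longrightarrow> d \<le> \<epsilon> B \<Longrightarrow>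
      pos_semidef n (map_mat (power_sum n c e M (C - d)) B)" by metis
  \<comment> \<open>The added element 1 keeps the minimum over a nonempty set when
    \<open>L = 0\<close>.\<close>
  define \<delta> where "\<delta> = Min (insert 1 ((\<lambda>l. \<epsilon> (A l)) ` {1..L}))"
  have "\<delta> > 0" using \<epsilon>(1) assms(8) by (auto simp: \<delta>_def)
  moreover have "\<delta> \<le> \<epsilon> (A l)" if "1 \<le> l" "l \<le> L" for l
    unfolding \<delta>_def by (rule Min_le) (use that in auto)
  ultimately have "\<forall>l. 1 \<le> l \<and> l \<le> L \<longrightarrow> pos_semidef n (map_mat (power_sum n c e M (C - \<delta>)) (A l))"
    using \<epsilon>(2) assms(8) by simp
  \<comment> \<open>Below the infimum of \<open>K\<close> positivity must fail for some
    matrix.\<close>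
  moreover have "C - \<delta> \<notin> K" using \<open>\<delta> > 0\<close> cInf_lower[OF _ bdd] by (force simp: C_def)
  ultimately show ?thesis by (auto simp: K_def)
qed

end
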